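(* Let $p\ge3$ and let $f:\mathbb R^p\to\mathbb R$ be convex and twice differentiable with $M$-Lipschitz gradient for some $M>0$, and with $\int_{\mathbb R^p}e^{-f}<\infty$. Let $\pi(\theta)=e^{-f(\theta)}/\int_{\mathbb R^p}e^{-f(v)}dv$, let $\theta^*$ be a minimizer of $f$ over $\mathbb R^p$, and let $\mu_a^*=\big(\int_{\mathbb R^p}\|\theta-\theta^*\|_2^a\,\pi(\theta)\,d\theta\big)^{1/a}$. Assume that for some positive $m$ and $R$ we have $\nabla^2f(\theta)\succeq mI_p$ for every $\theta\in\mathbb R^p$ such that $\|\theta-\theta^*\|_2>R$. Then, for every $a>0$, $$\mu_a^*\le\Big(1+\frac{2}{\Gamma(p/2)}\Big)^{1/a}\max\bigg\{4R,\ \Big(\frac{4(p+a)}{m}\log\Big(\frac{pM}{m}\Big)\Big)^{1/2}\bigg\}.$$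
   Context: $\Gamma$ is the Gamma function; $\succeq$ is the Loewner order on symmetric matrices. *)

theory Defs
  imports "HOL-Analysis.Analysis"
begin

definition gradient :: "('a::real_inner \<Rightarrow> real) \<Rightarrow> 'a \<Rightarrow> 'a" where
  "gradient f x = (THE D. GDERIV f x :> D)"

definition twice_differentiable :: "('a::real_inner \<Rightarrow> real) \<Rightarrow> bool" where
  "twice_differentiable f \<longleftrightarrow>
     (\<forall>x. f differentiable (at x)) \<and> (\<forall>x. gradient f differentiable (at x))"

definition hessian :: "(real ^ 'n \<Rightarrow> real) \<Rightarrow> real ^ 'n \<Rightarrow> real ^ 'n ^ 'n" where
  "hessian f x = jacobian (gradient f) (at x)"

text \<open>Symmetry is not part of the following two predicates. They are meant for symmetric
  matrices, and the Hessian of a (Frechet) twice differentiable function is always symmetric.\<close>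

definition psd :: "real ^ 'n ^ 'n \<Rightarrow> bool" where
  "psd A \<longleftrightarrow> (\<forall>v. 0 \<le> v \<bullet> (A *v v))"

definition loewner_ge :: "real ^ 'n ^ 'n \<Rightarrow> real ^ 'n ^ 'n \<Rightarrow> bool"  (infix \<open>\<succeq>\<close> 50) where
  "A \<succeq> B \<longleftrightarrow> psd (A - B)"

definition gibbs_density :: "('a::euclidean_space \<Rightarrow> real) \<Rightarrow> 'a \<Rightarrow> real" where
  "gibbs_density f \<theta> = exp (- f \<theta>) / (\<integral>v. exp (- f v) \<partial>lborel)"

text \<open>As a Bochner integral, the integral below is \<open>0\<close> when the moment is infinite, so
  bounds on it should be accompanied by integrability of the integrand.\<close>

definition centered_moment ::
    "('a::euclidean_space \<Rightarrow> real) \<Rightarrow> 'a \<Rightarrow> real \<Rightarrow> real" where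
  "centered_moment q c a = (\<integral>\<theta>. norm (\<theta> - c) powr a * q \<theta> \<partial>lborel) powr (1 / a)"

end

theory Submission
  imports Defs
begin

text \<open>
  Write \<open>r\<close> for the distance to the minimizer \<open>\<theta>s\<close>, \<open>B\<close> for the maximum in the bound and
  \<open>\<lambda> = 9 m / 32\<close>. Integrating the Hessian bound along rays gives \<open>f - f \<theta>s \<ge> m (r - R)\<^sup>2 / 2\<close>
  for \<open>r \<ge> R\<close>, which is at least \<open>\<lambda> r\<^sup>2\<close> for \<open>r \<ge> 4 R\<close>. The region \<open>r \<le> B\<close> contributes at most
  \<open>B\<^sup>a\<close> to the moment. On \<open>r > B\<close> polar coordinates are avoided by a Chernoff-type estimate:
  with \<open>q = p / (2 B\<^sup>2)\<close>, the function \<open>r\<^sup>a exp (- (\<lambda> - q) r\<^sup>2)\<close> decreases beyond \<open>B\<close>, so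
  \<open>r\<^sup>a exp (f \<theta>s - f) \<le> B\<^sup>a exp (- (\<lambda> - q) B\<^sup>2) exp (- q r\<^sup>2)\<close>. By scaling, the integral of
  \<open>exp (- q r\<^sup>2)\<close> is \<open>(M / (2 q))\<close> to the power \<open>p / 2\<close> times that of \<open>exp (- M r\<^sup>2 / 2)\<close>, and the
  Lipschitz bound \<open>f - f \<theta>s \<le> M r\<^sup>2 / 2\<close> compares the latter with the integral of
  \<open>exp (f \<theta>s - f)\<close>. The resulting constant is at most \<open>2 / \<Gamma>(p / 2)\<close>, since \<open>\<Gamma>(k)\<close> is at most
  three times \<open>(k / e)\<close> to the power \<open>k\<close> for half-integers \<open>k \<ge> 3 / 2\<close>.
\<close>

section \<open>Gradients along lines\<close>

text \<open>\<open>gradient\<close> is a definite description, so existence and uniqueness are both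
  due. The vector \<open>g\<close> representing the derivative is assembled from its values on the
  basis.\<close>

lemma GDERIV_gradient:
  fixes f :: "'a::euclidean_space \<Rightarrow> real"
  assumes "f differentiable (at x)"
  shows "GDERIV f x :> gradient f x"
proof -
  obtain D where D: "(f has_derivative D) (at x)"
    using assms by (auto simp: differentiable_def)
  define g where "g = (\<Sum>b\<in>Basis. D b *\<^sub>R b)"
  interpret D: linear D
    using D by (rule has_derivative_linear)
  have "D h = h \<bullet> g" for h
    by (subst euclidean_representation[of h, symmetric])
      (simp add: D.sum D.scaleR g_def inner_sum_right mult.commute)
  hence "D = (\<lambda>h. h \<bullet> g)"
    by (simp add: fun_eq_iff)
  hence g: "GDERIV f x :> g"
    using D by (simp add: gderiv_def)
  have "g' = g" if "GDERIV f x :> g'" for g'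
  proof -
    have "(\<lambda>h. h \<bullet> g') = (\<lambda>h. h \<bullet> g)"
      using that g unfolding gderiv_def by (rule has_derivative_unique)
    hence "h \<bullet> g' = h \<bullet> g" for h
      by (rule fun_cong)
    thus ?thesis
      using vector_eq_ldot[of g' g] by blast
  qed
  thus ?thesis
    unfolding gradient_def by (rule theI[where P = "\<lambda>D. GDERIV f x :> D", OF g])
qed

lemma DERIV_along_line:
  fixes f :: "'a::euclidean_space \<Rightarrow> real"
  assumes "f differentiable (at (x + t *\<^sub>R v))"
  shows "((\<lambda>t. f (x + t *\<^sub>R v)) has_real_derivative v \<bullet> gradient f (x + t *\<^sub>R v)) (at t)"
proof -
  have "((\<lambda>t. x + t *\<^sub>R v) has_derivative (\<lambda>h. h *\<^sub>R v)) (at t)"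
    by (auto intro!: derivative_eq_intros)
  moreover have "(f has_derivative (\<lambda>h. h \<bullet> gradient f (x + t *\<^sub>R v))) (at (x + t *\<^sub>R v))"
    using GDERIV_gradient[OF assms] by (simp add: gderiv_def)
  ultimately have "((\<lambda>t. f (x + t *\<^sub>R v)) has_derivative
      (\<lambda>h. (h *\<^sub>R v) \<bullet> gradient f (x + t *\<^sub>R v))) (at t)"
    by (rule has_derivative_compose)
  thus ?thesis
    by (simp add: has_field_derivative_def mult.commute[of _ "v \<bullet> _"])
qed

lemma DERIV_gradient_along_line:
  fixes f :: "real ^ 'n \<Rightarrow> real"
  assumes "gradient f differentiable (at (x + t *\<^sub>R v))"
  shows "((\<lambda>t. v \<bullet> gradient f (x + t *\<^sub>R v)) has_real_derivative
    v \<bullet> (hessian f (x + t *\<^sub>R v) *v v)) (at t)"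
proof -
  have "((\<lambda>t. x + t *\<^sub>R v) has_derivative (\<lambda>h. h *\<^sub>R v)) (at t)"
    by (auto intro!: derivative_eq_intros)
  moreover have "(gradient f has_derivative (\<lambda>h. hessian f (x + t *\<^sub>R v) *v h))
      (at (x + t *\<^sub>R v))"
    using assms by (simp add: hessian_def jacobian_works)
  ultimately have "((\<lambda>t. gradient f (x + t *\<^sub>R v)) has_derivative
      (\<lambda>h. hessian f (x + t *\<^sub>R v) *v (h *\<^sub>R v))) (at t)"
    by (rule has_derivative_compose)
  hence "((\<lambda>t. v \<bullet> gradient f (x + t *\<^sub>R v)) has_derivative
      (\<lambda>h. v \<bullet> (hessian f (x + t *\<^sub>R v) *v (h *\<^sub>R v)))) (at t)"
    by (rule has_derivative_inner_right)
  thus ?thesis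
    by (simp add: has_field_derivative_def matrix_vector_mult_scaleR mult.commute[of _ "v \<bullet> _"])
qed

lemma gradient_eq_0_at_minimum:
  fixes f :: "'a::euclidean_space \<Rightarrow> real"
  assumes "f differentiable (at x)" and "\<And>y. f x \<le> f y"
  shows "gradient f x = 0"
proof -
  let ?v = "gradient f x"
  have "((\<lambda>t. f (x + t *\<^sub>R ?v)) has_real_derivative ?v \<bullet> gradient f (x + 0 *\<^sub>R ?v)) (at 0)"
    by (rule DERIV_along_line) (simp add: assms)
  hence "?v \<bullet> gradient f (x + 0 *\<^sub>R ?v) = 0"
    by (rule DERIV_local_min[where d = 1]) (simp_all add: assms)
  thus ?thesis
    by simp
qed

text \<open>The gradient vanishes at the minimum, so the Lipschitz bound controls its size by
  \<open>M\<close> times the distance; integrate this along the segment to \<open>y\<close>.\<close>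

lemma quadratic_upper_bound_at_minimum:
  fixes f :: "'a::euclidean_space \<Rightarrow> real"
  assumes diff: "\<And>x. f differentiable (at x)" and lip: "M-lipschitz_on UNIV (gradient f)"
    and min: "\<And>y. f x \<le> f y"
  shows "f y - f x \<le> M * (norm (y - x))\<^sup>2 / 2"
proof -
  define v where "v = y - x"
  let ?h = "\<lambda>t. M * t\<^sup>2 * (norm v)\<^sup>2 / 2 - f (x + t *\<^sub>R v)"
  have grad0: "gradient f x = 0"
    by (rule gradient_eq_0_at_minimum) (use diff min in auto)
  have "?h 0 \<le> ?h 1"
  proof (rule DERIV_nonneg_imp_nondecreasing[where f = ?h and a = 0 and b = 1])
    fix t :: real assume t: "0 \<le> t" "t \<le> 1"
    have "(?h has_real_derivative M * t * (norm v)\<^sup>2 - v \<bullet> gradient f (x + t *\<^sub>R v)) (at t)"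
      by (rule derivative_eq_intros DERIV_along_line[OF diff] refl | simp)+
    moreover have "v \<bullet> gradient f (x + t *\<^sub>R v) \<le> M * t * (norm v)\<^sup>2"
    proof -
      have "norm (gradient f (x + t *\<^sub>R v)) \<le> M * norm (t *\<^sub>R v)"
        using lipschitz_onD[OF lip, of "x + t *\<^sub>R v" x] grad0 by (simp add: dist_norm)
      hence "norm v * norm (gradient f (x + t *\<^sub>R v)) \<le> norm v * (M * norm (t *\<^sub>R v))"
        by (rule mult_left_mono) simp
      also have "\<dots> = M * t * (norm v)\<^sup>2"
        using t by (simp add: power2_eq_square)
      finally show ?thesis
        using norm_cauchy_schwarz[of v "gradient f (x + t *\<^sub>R v)"] by linarith
    qed
    ultimately show "\<exists>d. (?h has_real_derivative d) (at t) \<and> d \<ge> 0"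
      by (intro exI conjI) auto
  qed simp
  thus ?thesis
    by (simp add: v_def)
qed

section \<open>Growth of \<open>f\<close> along rays from the center \<open>c\<close>\<close>

context
  fixes f :: "real ^ 'n \<Rightarrow> real" and c u :: "real ^ 'n" and m R :: real
  assumes diff2: "twice_differentiable f"
    and hess: "\<And>x. norm (x - c) > R \<Longrightarrow> hessian f x \<succeq> m *\<^sub>R mat 1"
    and R: "R > 0" and unit: "norm u = 1"
begin

lemma gradient_growth_along_ray:
  assumes "R \<le> s" "s \<le> t"
  shows "m * (t - s) \<le> u \<bullet> gradient f (c + t *\<^sub>R u) - u \<bullet> gradient f (c + s *\<^sub>R u)"
proof -
  let ?h = "\<lambda>t. u \<bullet> gradient f (c + t *\<^sub>R u) - m * t"
  have der: "(?h has_real_derivative u \<bullet> (hessian f (c + t *\<^sub>R u) *v u) - m) (at t)" for t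
    using diff2 by (auto simp: twice_differentiable_def intro!: derivative_eq_intros
        DERIV_gradient_along_line)
  have "?h s \<le> ?h t"
  \<comment> \<open>The Hessian bound holds only strictly outside radius \<open>R\<close>; the
    open-interval version of monotonicity still admits \<open>s = R\<close>.\<close>
  proof (rule DERIV_nonneg_imp_increasing_open[OF assms(2)])
    fix r assume r: "s < r" "r < t"
    have "norm (c + r *\<^sub>R u - c) > R"
      using r assms R unit by simp
    hence "0 \<le> u \<bullet> ((hessian f (c + r *\<^sub>R u) - m *\<^sub>R mat 1) *v u)"
      using hess unfolding loewner_ge_def psd_def by blast
    hence "0 \<le> u \<bullet> (hessian f (c + r *\<^sub>R u) *v u) - m"
      using unit by (simp add: matrix_vector_mult_diff_rdistrib scaleR_matrix_vector_assoc[symmetric]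
          inner_diff_right dot_square_norm)
    thus "\<exists>d. (?h has_real_derivative d) (at r) \<and> d \<ge> 0"
      using der by blast
  next
    show "continuous_on {s..t} ?h"
      using der DERIV_isCont by (blast intro: continuous_at_imp_continuous_on)
  qed
  thus ?thesis
    by (simp add: algebra_simps)
qed

text \<open>On the segment from radius \<open>R\<close> to \<open>R + 1\<close> the radial
  derivative gains at least \<open>m\<close> and at most \<open>M\<close>. This later keeps the
  logarithm in the bound at least 1.\<close>

lemma hessian_bound_le_lipschitz:
  assumes lip: "M-lipschitz_on UNIV (gradient f)"
  shows "m \<le> M"
proof -
  let ?d = "gradient f (c + (R + 1) *\<^sub>R u) - gradient f (c + R *\<^sub>R u)"
  have "m \<le> u \<bullet> ?d"
    using gradient_growth_along_ray[of R "R + 1"] by (simp add: inner_diff_right)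
  also have "\<dots> \<le> norm ?d"
    using norm_cauchy_schwarz[of u ?d] unit by simp
  also have "\<dots> \<le> M * norm (c + (R + 1) *\<^sub>R u - (c + R *\<^sub>R u))"
    using lipschitz_onD[OF lip, of "c + (R + 1) *\<^sub>R u" "c + R *\<^sub>R u"]
    by (simp add: dist_norm)
  also have "c + (R + 1) *\<^sub>R u - (c + R *\<^sub>R u) = u"
    by (simp add: algebra_simps)
  finally show ?thesis
    using unit by simp
qed

lemma quadratic_lower_bound_along_ray:
  assumes conv: "convex_on UNIV f" and min: "\<And>x. f c \<le> f x" and t: "R \<le> t"
  shows "m * (t - R)\<^sup>2 / 2 \<le> f (c + t *\<^sub>R u) - f c"
proof -
  let ?g = "\<lambda>t. f (c + t *\<^sub>R u)" and ?\<phi> = "\<lambda>t. u \<bullet> gradient f (c + t *\<^sub>R u)"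
  have der: "(?g has_real_derivative ?\<phi> t) (at t)" for t
    using diff2 by (auto simp: twice_differentiable_def intro!: DERIV_along_line)
  have "convex_on UNIV ?g"
  proof (rule convex_onI)
    fix s x y :: real assume "0 < s" "s < 1"
    hence "f ((1 - s) *\<^sub>R (c + x *\<^sub>R u) + s *\<^sub>R (c + y *\<^sub>R u))
        \<le> (1 - s) * ?g x + s * ?g y"
      by (intro convex_onD[OF conv]) auto
    thus "?g ((1 - s) *\<^sub>R x + s *\<^sub>R y) \<le> (1 - s) * ?g x + s * ?g y"
      by (simp add: algebra_simps)
  qed simp
  \<comment> \<open>Convexity enters here: the tangent at \<open>R\<close> lies below
    \<open>?g 0\<close>, which is minimal, so the radial derivative at \<open>R\<close> cannot be
    negative.\<close>
  hence "?g 0 - ?g R \<ge> ?\<phi> R * (0 - R)"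
    by (rule convex_on_imp_above_tangent) (auto intro: der)
  hence "R * ?\<phi> R \<ge> 0"
    using min[of "c + R *\<^sub>R u"] by (simp add: mult.commute)
  hence \<phi>R: "?\<phi> R \<ge> 0"
    using R by (simp add: zero_le_mult_iff)
  let ?h = "\<lambda>t. ?g t - m * (t - R)\<^sup>2 / 2"
  have "?h R \<le> ?h t"
  proof (rule DERIV_nonneg_imp_nondecreasing[where f = ?h, OF t])
    fix r assume r: "R \<le> r" "r \<le> t"
    have "(?h has_real_derivative ?\<phi> r - m * (r - R)) (at r)"
      by (rule derivative_eq_intros der refl | simp)+
    moreover have "?\<phi> r - m * (r - R) \<ge> 0"
      using gradient_growth_along_ray[of R r] r \<phi>R by simp
    ultimately show "\<exists>d. (?h has_real_derivative d) (at r) \<and> d \<ge> 0"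
      by blast
  qed
  thus ?thesis
    using min[of "c + R *\<^sub>R u"] by simp
qed

end

section \<open>Gaussian integrals\<close>

text \<open>Dilating about \<open>c\<close> by \<open>sqrt (s / t)\<close> turns one Gaussian into
  the other. Only the ratio of the two integrals matters later, so neither is evaluated.\<close>

lemma gaussian_scaling:
  fixes c :: "'a::euclidean_space"
  assumes s: "s > 0" and t: "t > 0"
    and int: "integrable lborel (\<lambda>x::'a. exp (- s * (norm (x - c))\<^sup>2))"
  shows "integrable lborel (\<lambda>x::'a. exp (- t * (norm (x - c))\<^sup>2))" (is ?thesis1)
    and "(\<integral>x. exp (- t * (norm (x - c))\<^sup>2) \<partial>lborel)
      = (s / t) powr (real DIM('a) / 2) * (\<integral>x. exp (- s * (norm (x - c))\<^sup>2) \<partial>lborel)" (is ?thesis2)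
proof -
  define k where "k = sqrt (s / t)"
  have k: "k > 0"
    using s t by (simp add: k_def)
  define T where "T = (\<lambda>x. (c - k *\<^sub>R c) + k *\<^sub>R x)"
  have [measurable]: "T \<in> borel_measurable borel"
    by (simp add: T_def)
  have lb: "lborel = density (distr lborel borel T) (\<lambda>_. ennreal (k ^ DIM('a)))"
    using lborel_affine[of k "c - k *\<^sub>R c"] k by (simp add: T_def ennreal_power)
  let ?g = "\<lambda>x. exp (- t * (norm (x - c))\<^sup>2)"
  have T: "exp (- t * (norm (T x - c))\<^sup>2) = exp (- s * (norm (x - c))\<^sup>2)" for x
  proof -
    have "T x - c = k *\<^sub>R (x - c)"
      by (simp add: T_def algebra_simps)
    moreover have "t * k\<^sup>2 = s"
      using s t by (simp add: k_def)
    ultimately show ?thesis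
      using k by (simp add: power_mult_distrib mult.assoc[symmetric])
  qed
  show ?thesis1
    using int k arg_cong[OF lb, of "\<lambda>N. integrable N ?g"]
    by (simp add: integrable_density integrable_distr_eq T[simplified])
  have "(\<integral>x. exp (- t * (norm (x - c))\<^sup>2) \<partial>lborel)
      = k ^ DIM('a) * (\<integral>x. exp (- s * (norm (x - c))\<^sup>2) \<partial>lborel)"
    using k arg_cong[OF lb, of "\<lambda>N. integral\<^sup>L N ?g"]
    by (simp add: integral_density integral_distr T[simplified])
  also have "k ^ DIM('a) = (s / t) powr (real DIM('a) / 2)"
    using s t by (simp add: k_def powr_half_sqrt[symmetric] powr_realpow[symmetric] powr_powr)
  finally show ?thesis2 .
qed

section \<open>Numerical estimates\<close>

text \<open>The logarithmic derivative \<open>a / r - 2 * l * r\<close> is nonpositive from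
  \<open>B\<close> on. Instead of differentiating, the proof applies \<open>ln y \<le> y - 1\<close>
  to \<open>y = (r / B)\<^sup>2\<close>.\<close>

lemma powr_exp_decreasing:
  fixes a l B r :: real
  assumes "0 < B" "B \<le> r" "0 \<le> a" "a \<le> 2 * l * B\<^sup>2"
  shows "r powr a * exp (- l * r\<^sup>2) \<le> B powr a * exp (- l * B\<^sup>2)"
proof -
  have "ln (r / B) = ln ((r / B)\<^sup>2) / 2"
    using assms by (simp add: ln_realpow)
  also have "\<dots> \<le> ((r / B)\<^sup>2 - 1) / 2"
    using assms by (intro divide_right_mono ln_le_minus_one) auto
  finally have "a * ln (r / B) \<le> a * (((r / B)\<^sup>2 - 1) / 2)"
    using assms by (intro mult_left_mono)
  also have "\<dots> \<le> 2 * l * B\<^sup>2 * (((r / B)\<^sup>2 - 1) / 2)"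
    using assms by (intro mult_right_mono) (auto simp: field_simps)
  also have "\<dots> = l * r\<^sup>2 - l * B\<^sup>2"
    using assms by (simp add: field_simps)
  finally have "a * ln r - l * r\<^sup>2 \<le> a * ln B - l * B\<^sup>2"
    using assms by (simp add: ln_div algebra_simps)
  thus ?thesis
    using assms by (simp add: powr_def exp_add[symmetric])
qed

text \<open>Induction in steps of two with base cases 3 and 4. The step from \<open>s\<close> to
  \<open>s + 1\<close> amounts to \<open>(s / (s + 1)) powr (s + 1) \<le> exp (- 1)\<close>.\<close>

lemma Gamma_half_nat_le:
  assumes "n \<ge> 3"
  shows "Gamma (real n / 2) \<le> 3 * (real n / (2 * exp 1)) powr (real n / 2)"
  using assms
proof (induction n rule: less_induct)
  case (less n)
  have e3: "(0::real) < exp 1" "exp 1 \<le> (3::real)"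
    by (simp_all add: exp_le)
  consider "n = 3" | "n = 4" | "n \<ge> 5"
    using less.prems by linarith
  thus ?case
  proof cases
    assume n: "n = 3"
    have "(1 / 2 :: real) \<notin> \<int>\<^sub>\<le>\<^sub>0"
      using nonpos_Ints_nonpos[of "1 / 2 :: real"] by auto
    hence "Gamma (3 / 2 :: real) = sqrt pi / 2"
      using Gamma_plus1[of "1 / 2 :: real"] by (simp add: Gamma_one_half_real)
    also have "\<dots> \<le> 1"
      using real_sqrt_le_mono[of pi 4] pi_less_4 by simp
    \<comment> \<open>Here \<open>1 / 2\<close> is a lower bound for \<open>3 / (2 * exp 1)\<close>,
      since \<open>exp 1 \<le> 3\<close>. Squaring reduces the claim to 1/9 \<le> 1/8.\<close>
    also have "1 \<le> 3 * (1 / 2 :: real) powr (3 / 2)"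
    proof -
      have "((1 / 2 :: real) powr (3 / 2))\<^sup>2 = (1 / 2) powr 3"
        by (simp add: powr_power)
      also have "\<dots> = 1 / 8"
        by (simp add: powr_numeral power3_eq_cube)
      finally have "(1 / 3)\<^sup>2 \<le> ((1 / 2 :: real) powr (3 / 2))\<^sup>2"
        by (simp add: power2_eq_square)
      hence "1 / 3 \<le> (1 / 2 :: real) powr (3 / 2)"
        by (rule power2_le_imp_le) simp
      thus ?thesis
        by simp
    qed
    also have "\<dots> \<le> 3 * (3 / (2 * exp 1)) powr (3 / 2)"
      using e3 by (intro mult_left_mono powr_mono2) (auto simp: field_simps)
    finally show ?case
      using n by simp
  next
    assume n: "n = 4"
    have "Gamma (2 :: real) = 1"
      using Gamma_fact[of 1, where 'a = real] by simp
    also have "1 \<le> 3 * (4 / (2 * exp 1)) powr (2 :: real)"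
    proof -
      have "(exp 1)\<^sup>2 \<le> (3 :: real)\<^sup>2"
        using e3 by (intro power_mono) auto
      thus ?thesis
        by (simp add: powr_numeral power2_eq_square field_simps)
    qed
    finally show ?case
      using n by simp
  next
    assume n: "n \<ge> 5"
    define s where "s = real n / 2 - 1"
    have s: "s > 0"
      using n by (simp add: s_def)
    have ns: "real n = 2 * (s + 1)" "real (n - 2) = 2 * s"
      using n by (auto simp: s_def)
    have IH: "Gamma s \<le> 3 * (s / exp 1) powr s"
      using less.IH[of "n - 2"] n ns by simp
    have "Gamma (s + 1) = s * Gamma s"
      using s by (intro Gamma_plus1) (auto dest: nonpos_Ints_nonpos)
    also have "\<dots> \<le> s * (3 * (s / exp 1) powr s)"
      using IH s by (intro mult_left_mono) auto
    also have "\<dots> \<le> 3 * ((s + 1) / exp 1) powr (s + 1)"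
    proof -
      have "ln (s / (s + 1)) \<le> s / (s + 1) - 1"
        using s by (intro ln_le_minus_one) auto
      hence "(s + 1) * (ln s - ln (s + 1)) \<le> (s + 1) * (s / (s + 1) - 1)"
        using s by (intro mult_left_mono) (auto simp: ln_div)
      also have "\<dots> = - 1"
        using s by (simp add: field_simps)
      finally have "ln s + s * (ln s - 1) \<le> (s + 1) * (ln (s + 1) - 1)"
        by (simp add: algebra_simps)
      hence "exp (ln s + s * (ln s - 1)) \<le> exp ((s + 1) * (ln (s + 1) - 1))"
        by simp
      hence "s * (s / exp 1) powr s \<le> ((s + 1) / exp 1) powr (s + 1)"
        using s by (simp add: powr_def ln_div exp_add)
      thus ?thesis
        by simp
    qed
    finally have "Gamma (s + 1) \<le> 3 * ((s + 1) / exp 1) powr (s + 1)" .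
    moreover have "real n / 2 = s + 1" "real n / (2 * exp 1) = (s + 1) / exp 1"
      unfolding ns by (simp_all add: field_simps)
    ultimately show ?case
      by (simp only:)
  qed
qed

text \<open>With \<open>k\<close>, \<open>z\<close> and \<open>L\<close> as below, the left side is
  the exponential of \<open>k * (1 + ln 2 + ln z + L - ln k - 9 / 4 * z)\<close>. The term 9/4 z
  absorbs both \<open>L\<close> and \<open>ln z\<close>, and what remains is compared with the Gamma
  bound.\<close>

lemma tail_constant_le:
  fixes m M B :: real
  assumes n: "n \<ge> 3" and m: "0 < m" "m \<le> M" and B: "0 < B"
    and mB: "4 * real n * ln (real n * M / m) \<le> m * B\<^sup>2"
  shows "exp (real n / 2 - 9 / 32 * m * B\<^sup>2) * (M * B\<^sup>2 / real n) powr (real n / 2)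
    \<le> 2 / Gamma (real n / 2)"
proof -
  define k where "k = real n / 2"
  have k: "k \<ge> 3 / 2" and nk: "real n = 2 * k"
    using n by (simp_all add: k_def)
  define L where "L = ln (real n * M / m)"
  define z where "z = m * B\<^sup>2 / (4 * real n)"
  have Lz: "L \<le> z"
    using mB n by (simp add: L_def z_def field_simps)
  have "real n * 1 \<le> real n * (M / m)"
    using m by (intro mult_left_mono) auto
  hence "exp 1 \<le> real n * M / m"
    using exp_le n by simp
  hence L1: "1 \<le> L"
    unfolding L_def using m n by (subst ln_ge_iff) auto
  have z1: "1 \<le> z"
    using Lz L1 by simp
  have "M * B\<^sup>2 / real n = 4 * z * exp L / real n"
    using m n B by (simp add: L_def z_def field_simps)
  hence lnM: "ln (M * B\<^sup>2 / real n) = ln 2 + ln z + L - ln k"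
    using z1 k nk by (simp add: ln_mult ln_div)
  have ln2: "ln 2 \<le> (3 / 4 :: real)"
  proof -
    have "2 \<le> 1 + 3 / 4 + (3 / 4 :: real)\<^sup>2 / 2"
      by (simp add: power2_eq_square)
    also have "\<dots> \<le> exp (3 / 4)"
      by (rule exp_lower_Taylor_quadratic) simp
    finally have "ln 2 \<le> ln (exp (3 / 4 :: real))"
      by (subst ln_le_cancel_iff) auto
    thus ?thesis
      by simp
  qed
  have pos: "0 < M * B\<^sup>2 / real n"
    using m n B by simp
  have "exp (real n / 2 - 9 / 32 * m * B\<^sup>2) * (M * B\<^sup>2 / real n) powr (real n / 2)
      = exp (k * (1 + ln 2 + ln z + L - ln k - 9 / 4 * z))"
  proof -
    have "real n / 2 - 9 / 32 * m * B\<^sup>2 = k - k * (9 / 4 * z)"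
      using n k by (simp add: z_def nk field_simps)
    moreover have "(M * B\<^sup>2 / real n) powr (real n / 2) = exp (k * (ln 2 + ln z + L - ln k))"
      unfolding powr_def lnM k_def[symmetric] using pos n by auto
    ultimately show ?thesis
      by (simp add: exp_add[symmetric] algebra_simps)
  qed
  also have "\<dots> \<le> exp (k * (1 - ln k) - 3 / 4)"
  proof -
    have "ln z \<le> z - 1"
      using z1 by (intro ln_le_minus_one) auto
    \<comment> \<open>The left side is at most 3/4 + (z - 1) + z - 9/4 z = -1/4 - z/4, and z \<ge>
      1.\<close>
    hence "ln 2 + ln z + L - 9 / 4 * z \<le> - 1 / 2"
      using ln2 Lz z1 by argo
    hence "k * (ln 2 + ln z + L - 9 / 4 * z) \<le> k * (- 1 / 2)"
      using k by (intro mult_left_mono) auto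
    also have "\<dots> \<le> - 3 / 4"
      using k by simp
    finally show ?thesis
      by (simp add: algebra_simps)
  qed
  also have "\<dots> = exp (k * (1 - ln k)) / exp (3 / 4)"
    by (simp add: exp_diff)
  \<comment> \<open>The divisor 3/2 yields the factor 2/3, whose 3 matches the constant in
    \<open>Gamma_half_nat_le\<close>.\<close>
  also have "\<dots> \<le> exp (k * (1 - ln k)) / (3 / 2)"
    using exp_ge_add_one_self[of "3 / 4 :: real"] by (intro divide_left_mono) auto
  also have "\<dots> = 2 / (3 * (real n / (2 * exp 1)) powr (real n / 2))"
  proof -
    have "(real n / (2 * exp 1)) powr (real n / 2) = exp (- (k * (1 - ln k)))"
      using k by (simp add: nk powr_def ln_div algebra_simps)
    thus ?thesis
      by (simp only: exp_minus divide_inverse inverse_mult_distrib inverse_inverse_eq) simp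
  qed
  also have "\<dots> \<le> 2 / Gamma (real n / 2)"
    using Gamma_half_nat_le[OF n] n by (intro divide_left_mono) (auto intro!: mult_pos_pos Gamma_real_pos)
  finally show ?thesis .
qed

section \<open>The moment bound\<close>

theorem proposition3:
  fixes f :: "real ^ 'n \<Rightarrow> real" and \<theta>s :: "real ^ 'n"
    and p :: nat and M m R a :: real
  assumes "CARD('n) = p" and "p \<ge> 3"
    and "convex_on UNIV f"
    and "twice_differentiable f"
    and "M > 0" and "M-lipschitz_on UNIV (gradient f)"
    and "integrable lborel (\<lambda>\<theta>. exp (- f \<theta>))"
    and "\<And>\<theta>. f \<theta>s \<le> f \<theta>"
    and "m > 0" and "R > 0"
    and "\<And>\<theta>. norm (\<theta> - \<theta>s) > R \<Longrightarrow> hessian f \<theta> \<succeq> m *\<^sub>R mat 1"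
    and "a > 0"
  shows "integrable lborel (\<lambda>\<theta>. norm (\<theta> - \<theta>s) powr a * gibbs_density f \<theta>) \<and>
    centered_moment (gibbs_density f) \<theta>s a
      \<le> (1 + 2 / Gamma (real p / 2)) powr (1 / a) *
         max (4 * R) (sqrt (4 * (real p + a) / m * ln (real p * M / m)))"
proof -
  have diff: "\<And>x. f differentiable (at x)"
    using assms(4) by (simp add: twice_differentiable_def)
  have [measurable]: "f \<in> borel_measurable borel"
    using diff by (intro borel_measurable_continuous_onI)
      (auto intro!: continuous_at_imp_continuous_on differentiable_imp_continuous_within)
  define L where "L = ln (real p * M / m)"
  define B where "B = max (4 * R) (sqrt (4 * (real p + a) / m * L))"
  \<comment> \<open>This choice minimizes
    \<open>exp (q * B\<^sup>2) * q powr (- real p / 2)\<close>, the dependence of the tail bound on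
    \<open>q\<close>.\<close>
  define q where "q = real p / (2 * B\<^sup>2)"
  define l where "l = 9 / 32 * m - q"
  define Z where "Z = (\<integral>v. exp (- f v) \<partial>lborel)"
  let ?r = "\<lambda>x. norm (x - \<theta>s)"
  obtain u :: "real ^ 'n" where u: "norm u = 1"
    using vector_choose_size[of 1] by auto
  have mM: "m \<le> M"
    using hessian_bound_le_lipschitz[OF assms(4) assms(11) assms(10) u assms(6)] .
  have B: "B > 0" "4 * R \<le> B"
    using assms(10) by (auto simp: B_def)
  have q: "q > 0"
    using B assms(2) by (simp add: q_def)
  have "real p * 1 \<le> real p * (M / m)"
    using mM assms by (intro mult_left_mono) auto
  hence "exp 1 \<le> real p * M / m"
    using exp_le assms(2) by simp
  hence L1: "1 \<le> L"
    unfolding L_def using assms by (subst ln_ge_iff) auto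
  have mB: "4 * (real p + a) * L \<le> m * B\<^sup>2"
  proof -
    have "sqrt (4 * (real p + a) / m * L) \<le> B"
      by (simp add: B_def)
    hence "4 * (real p + a) / m * L \<le> B\<^sup>2"
      by (rule sqrt_le_D)
    thus ?thesis
      using assms(9) by (simp add: field_simps)
  qed
  have "4 * (real p + a) * 1 \<le> 4 * (real p + a) * L"
    using L1 assms(12) by (intro mult_left_mono) auto
  hence "4 * (real p + a) \<le> m * B\<^sup>2"
    using mB by simp
  moreover have "2 * l * B\<^sup>2 = 9 / 16 * (m * B\<^sup>2) - real p"
    using B by (simp add: l_def q_def field_simps)
  \<comment> \<open>The right side is at least 9/4 (p + a) - p, which exceeds a.\<close>
  ultimately have al: "a \<le> 2 * l * B\<^sup>2"
    using assms(12) by simp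
  have "4 * real p * L \<le> 4 * (real p + a) * L"
    using L1 assms(12) by (intro mult_right_mono) auto
  hence "4 * real p * L \<le> m * B\<^sup>2"
    using mB by simp
  moreover have "- l * B\<^sup>2 = real p / 2 - 9 / 32 * m * B\<^sup>2" "M / 2 / q = M * B\<^sup>2 / real p"
    using B by (auto simp: l_def q_def field_simps)
  ultimately have const: "exp (- l * B\<^sup>2) * (M / 2 / q) powr (real p / 2) \<le> 2 / Gamma (real p / 2)"
    using tail_constant_le[OF assms(2,9) mM B(1)] by (simp only: L_def)

  have upper: "exp (- (M / 2) * (?r x)\<^sup>2) \<le> exp (f \<theta>s) * exp (- f x)" for x
    using quadratic_upper_bound_at_minimum[OF diff assms(6,8), of x]
    by (simp add: exp_add[symmetric])
  \<comment> \<open>Domination by \<open>exp (- f x)\<close> gives integrability of this Gaussian,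
    and scaling then passes it on to the one with rate \<open>q\<close>.\<close>
  have int_M: "integrable lborel (\<lambda>x. exp (- (M / 2) * (?r x)\<^sup>2))"
  proof (rule Bochner_Integration.integrable_bound)
    show "integrable lborel (\<lambda>x. exp (f \<theta>s) * exp (- f x))"
      using assms(7) by simp
    show "AE x in lborel. norm (exp (- (M / 2) * (?r x)\<^sup>2)) \<le> norm (exp (f \<theta>s) * exp (- f x))"
      unfolding real_norm_def abs_mult abs_exp_cancel using upper by (rule AE_I2)
  qed simp
  have "M / 2 > 0"
    using assms(5) by simp
  note gs = gaussian_scaling[OF this q int_M]
  have DIM: "DIM(real ^ 'n) = p"
    using assms(1) by simp
  have "(\<integral>x. exp (- (M / 2) * (?r x)\<^sup>2) \<partial>lborel) \<le> (\<integral>x. exp (f \<theta>s) * exp (- f x) \<partial>lborel)"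
    using int_M assms(7) upper by (intro integral_mono) auto
  hence IM: "(\<integral>x. exp (- (M / 2) * (?r x)\<^sup>2) \<partial>lborel) \<le> exp (f \<theta>s) * Z"
    by (simp add: Z_def)

  have tail: "?r x powr a * exp (- f x)
      \<le> B powr a * exp (- f \<theta>s - l * B\<^sup>2) * exp (- q * (?r x)\<^sup>2)" if x: "?r x > B" for x
  proof -
    define v where "v = (x - \<theta>s) /\<^sub>R ?r x"
    have "?r x \<noteq> 0"
      using x B by linarith
    hence v: "norm v = 1" "x = \<theta>s + ?r x *\<^sub>R v"
      unfolding v_def by simp_all
    have "m * (?r x - R)\<^sup>2 / 2 \<le> f (\<theta>s + ?r x *\<^sub>R v) - f \<theta>s"
      by (rule quadratic_lower_bound_along_ray[OF assms(4) assms(11) assms(10) v(1) assms(3,8)])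
        (use x B assms(10) in auto)
    \<comment> \<open>Since \<open>4 * R \<le> B < ?r x\<close>, at least three quarters of the
      radius remain; half the square of 3/4 is the 9/32 in \<open>l\<close>.\<close>
    moreover have "(3 / 4 * ?r x)\<^sup>2 \<le> (?r x - R)\<^sup>2"
      using x B assms(10) by (intro power_mono) auto
    hence "m * (3 / 4 * ?r x)\<^sup>2 / 2 \<le> m * (?r x - R)\<^sup>2 / 2"
      using assms(9) by (intro divide_right_mono mult_left_mono) auto
    ultimately have "9 / 32 * m * (?r x)\<^sup>2 \<le> f x - f \<theta>s"
      using v(2) by (simp add: power_mult_distrib power_divide)
    hence "- f x \<le> - f \<theta>s + - l * (?r x)\<^sup>2 + - q * (?r x)\<^sup>2"
      by (simp add: l_def algebra_simps)
    hence "exp (- f x) \<le> exp (- f \<theta>s) * exp (- l * (?r x)\<^sup>2) * exp (- q * (?r x)\<^sup>2)"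
      by (simp only: exp_add[symmetric] exp_le_cancel_iff)
    hence "?r x powr a * exp (- f x) \<le>
        ?r x powr a * (exp (- f \<theta>s) * exp (- l * (?r x)\<^sup>2) * exp (- q * (?r x)\<^sup>2))"
      by (rule mult_left_mono) simp
    also have "\<dots> = exp (- f \<theta>s) * (?r x powr a * exp (- l * (?r x)\<^sup>2)) * exp (- q * (?r x)\<^sup>2)"
      by (simp only: mult_ac)
    also have "\<dots> \<le> exp (- f \<theta>s) * (B powr a * exp (- l * B\<^sup>2)) * exp (- q * (?r x)\<^sup>2)"
      using x B al assms(12)
      by (intro mult_right_mono mult_left_mono powr_exp_decreasing) auto
    finally show ?thesis
      by (simp add: exp_diff exp_minus field_simps)
  qed
  let ?F = "\<lambda>x. ?r x powr a * exp (- f x)"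
  \<comment> \<open>The bounds inside and outside the ball are added, so one dominating function
    serves everywhere and no integral has to be split.\<close>
  let ?G = "\<lambda>x. B powr a * exp (- f x)
      + B powr a * exp (- f \<theta>s - l * B\<^sup>2) * exp (- q * (?r x)\<^sup>2)"
  have FG: "?F x \<le> ?G x" for x
  proof (cases "?r x > B")
    case True
    thus ?thesis
      using tail[OF True] by (simp add: add_increasing)
  next
    case False
    hence "?F x \<le> B powr a * exp (- f x)"
      using assms(12) by (intro mult_right_mono powr_mono2) auto
    thus ?thesis
      by (simp add: add_increasing2)
  qed
  have int_G: "integrable lborel ?G"
    using assms(7) gs(1) by auto
  have int_F: "integrable lborel ?F"
  proof (rule Bochner_Integration.integrable_bound[OF int_G])
    have "norm (?F x) \<le> norm (?G x)" for x
    proof -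
      have "norm (?F x) = ?F x"
        by simp
      also have "\<dots> \<le> norm (?G x)"
        using FG[of x] by (simp only: real_norm_def)
      finally show ?thesis .
    qed
    thus "AE x in lborel. norm (?F x) \<le> norm (?G x)"
      by (rule AE_I2)
  qed simp
  have Zpos: "Z > 0"
  proof -
    have "Z \<ge> 0"
      by (simp add: Z_def)
    \<comment> \<open>A nonnegative integrand with integral 0 vanishes almost everywhere, but
      \<open>exp\<close> has no zeros and \<open>lborel\<close> is not the null measure.\<close>
    moreover have "Z \<noteq> 0"
      unfolding Z_def using assms(7)
      by (subst integral_nonneg_eq_0_iff_AE) (auto simp: eventually_False ae_filter_eq_bot_iff)
    ultimately show ?thesis
      by simp
  qed
  have gF: "?r x powr a * gibbs_density f x = ?F x / Z" for x
    by (simp add: gibbs_density_def Z_def)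
  have int: "integrable lborel (\<lambda>x. ?r x powr a * gibbs_density f x)"
    unfolding gF using int_F by simp

  define \<Gamma> where "\<Gamma> = 2 / Gamma (real p / 2)"
  have \<Gamma>: "\<Gamma> \<ge> 0"
    using assms(2) Gamma_real_pos[of "real p / 2"] by (simp add: \<Gamma>_def)
  have "(\<integral>x. ?F x \<partial>lborel) \<le> (\<integral>x. ?G x \<partial>lborel)"
    using int_F int_G FG by (rule integral_mono)
  also have "\<dots> = B powr a * Z + B powr a * exp (- f \<theta>s - l * B\<^sup>2) *
      ((M / 2 / q) powr (real p / 2) * (\<integral>x. exp (- (M / 2) * (?r x)\<^sup>2) \<partial>lborel))"
    using assms(7) gs(1) by (simp add: Z_def gs(2)[unfolded DIM, simplified])
  \<comment> \<open>Bounding the Gaussian integral by a multiple of \<open>Z\<close> lets the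
    normalization and the factors \<open>exp (f \<theta>s)\<close> cancel.\<close>
  also have "\<dots> \<le> B powr a * Z + B powr a * exp (- f \<theta>s - l * B\<^sup>2) *
      ((M / 2 / q) powr (real p / 2) * (exp (f \<theta>s) * Z))"
    using IM by (intro add_left_mono mult_left_mono) auto
  also have "\<dots> = B powr a * Z * (1 + exp (- l * B\<^sup>2) * (M / 2 / q) powr (real p / 2))"
    by (simp add: exp_diff exp_minus field_simps)
  also have "\<dots> \<le> B powr a * Z * (1 + \<Gamma>)"
    using const Zpos by (intro mult_left_mono add_left_mono) (auto simp: \<Gamma>_def)
  finally have "(\<integral>x. ?F x \<partial>lborel) / Z \<le> (1 + \<Gamma>) * B powr a"
    using Zpos by (simp add: field_simps)
  hence "(\<integral>x. ?r x powr a * gibbs_density f x \<partial>lborel) \<le> (1 + \<Gamma>) * B powr a"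
    unfolding gF by simp
  moreover have "0 \<le> (\<integral>x. ?r x powr a * gibbs_density f x \<partial>lborel)"
    unfolding gF using Zpos by (intro integral_nonneg_AE) auto
  ultimately have "centered_moment (gibbs_density f) \<theta>s a \<le> ((1 + \<Gamma>) * B powr a) powr (1 / a)"
    unfolding centered_moment_def using assms(12) by (intro powr_mono2) auto
  also have "\<dots> = (1 + \<Gamma>) powr (1 / a) * B"
    using assms(12) B \<Gamma> by (simp add: powr_mult powr_powr)
  finally show ?thesis
    using int by (simp add: B_def L_def \<Gamma>_def)
qed

end
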